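(* Let $X$ be a real Banach space with dual $X^*$, and let $T\subseteq X\times X^*$ be a maximal monotone operator. Then there exists $h\in\mathcal{H}(T)$ such that $\mathcal{J}h=h$.
   Context: Let $X$ be a real Banach space, $X^*$ its dual, and $\overline{\mathbb{R}}=\mathbb{R}\cup\{-\infty,+\infty\}$. Write $\langle x,x^*\rangle=x^*(x)$ for $x\in X$, $x^*\in X^*$. A point-to-set operator $T$ from $X$ to $X^*$ is identified with its graph $\{(x,x^* )\in X\times X^* : x^*\in T(x)\}$. $T$ is monotone if $\langle x-y,x^*-y^*\rangle\ge 0$ for all $(x,x^* ),(y,y^* )\in T$. It is maximal monotone if it is monotone and, whenever $(x,x^* )\in X\times X^*$ satisfies $\langle x-y,x^*-y^*\rangle\ge 0$ for all $(y,y^* )\in T$, then $(x,x^* )\in T$. For a maximal monotone operator $T$, $\mathcal{H}(T)$ denotes the family of convex lower semicontinuous functions $h:X\times X^*\to\overline{\mathbb{R}}$ such that $h(x,x^* )\ge\langle x,x^*\rangle$ for all $(x,x^* )\in X\times X^*$, and $h(x,x^* )=\langle x,x^*\rangle$ whenever $(x,x^* )\in T$. For a function $h:X\times X^*\to\overline{\mathbb{R}}$, define $\mathcal{J}h:X\times X^*\to\overline{\mathbb{R}}$ by $$\mathcal{J}h(x,x^* )=\sup_{(y,y^* )\in X\times X^*}\ \langle x,y^*\rangle+\langle y,x^*\rangle-h(y,y^* ).$$ *)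

theory Defs
  imports "HOL-Analysis.Analysis"
begin

text \<open>The dual of \<open>X\<close> is the type \<open>'a \<Rightarrow>\<^sub>L real\<close> of bounded linear functionals, and
  \<open>X \<times> X\<^sup>*\<close> carries the norm topology of the product type.\<close>

definition duality :: "'a::real_normed_vector \<Rightarrow> ('a \<Rightarrow>\<^sub>L real) \<Rightarrow> real"
  where "duality x xs = blinfun_apply xs x"

definition monotone_op :: "('a::real_normed_vector \<times> ('a \<Rightarrow>\<^sub>L real)) set \<Rightarrow> bool"
  where "monotone_op T \<longleftrightarrow>
    (\<forall>(x, xs)\<in>T. \<forall>(y, ys)\<in>T. 0 \<le> duality (x - y) (xs - ys))"

definition maximal_monotone_op :: "('a::real_normed_vector \<times> ('a \<Rightarrow>\<^sub>L real)) set \<Rightarrow> bool"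
  where "maximal_monotone_op T \<longleftrightarrow> monotone_op T \<and>
    (\<forall>x xs. (\<forall>(y, ys)\<in>T. 0 \<le> duality (x - y) (xs - ys)) \<longrightarrow> (x, xs) \<in> T)"

text \<open>The library's \<open>convex_on\<close> is restricted to real-valued functions. For values in
  \<open>ereal\<close> we have \<open>0 * \<infinity> = 0\<close> and \<open>\<infinity> + (-\<infinity>) = \<infinity>\<close>, so that the usual inequality
  amounts to convexity of the epigraph, as the lemma below confirms.\<close>

definition convex_ereal :: "('b::real_vector \<Rightarrow> ereal) \<Rightarrow> bool"
  where "convex_ereal f \<longleftrightarrow>
    (\<forall>x y. \<forall>u\<ge>0. \<forall>v\<ge>0. u + v = 1 \<longrightarrow>
      f (u *\<^sub>R x + v *\<^sub>R y) \<le> ereal u * f x + ereal v * f y)"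

lemma convex_ereal_iff_convex_epigraph:
  "convex_ereal f \<longleftrightarrow> convex {(x, r::real). f x \<le> ereal r}"
proof
  assume f: "convex_ereal f"
  show "convex {(x, r::real). f x \<le> ereal r}"
  proof (rule convexI, clarsimp)
    fix x y r s and u v :: real
    assume *: "f x \<le> ereal r" "f y \<le> ereal s" "0 \<le> u" "0 \<le> v" "u + v = 1"
    have "f (u *\<^sub>R x + v *\<^sub>R y) \<le> ereal u * f x + ereal v * f y"
      using f * unfolding convex_ereal_def by blast
    also have "\<dots> \<le> ereal u * ereal r + ereal v * ereal s"
      using * by (intro add_mono ereal_mult_left_mono) auto
    finally show "f (u *\<^sub>R x + v *\<^sub>R y) \<le> ereal (u * r + v * s)" by simp
  qed
next
  assume E: "convex {(x, r::real). f x \<le> ereal r}"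
  have E': "f (u *\<^sub>R x + v *\<^sub>R y) \<le> ereal (u * r + v * s)"
    if "f x \<le> ereal r" "f y \<le> ereal s" "0 \<le> u" "0 \<le> v" "u + v = 1" for x y r s u v
    using convexD[OF E, of "(x, r)" "(y, s)" u v] that by simp
  show "convex_ereal f"
    unfolding convex_ereal_def
  proof (intro allI impI)
    fix x y and u v :: real
    assume uv: "0 \<le> u" "0 \<le> v" "u + v = 1"
    show "f (u *\<^sub>R x + v *\<^sub>R y) \<le> ereal u * f x + ereal v * f y"
    proof (cases "u = 0 \<or> v = 0")
      case True
      with uv show ?thesis by (auto simp flip: zero_ereal_def one_ereal_def)
    next
      case False
      with uv have pos: "u > 0" "v > 0" by auto
      show ?thesis
      proof (rule ccontr)
        assume "\<not> ?thesis"
        then have lt: "ereal u * f x + ereal v * f y < f (u *\<^sub>R x + v *\<^sub>R y)" by simp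
        then have fin: "f x \<noteq> \<infinity>" "f y \<noteq> \<infinity>" using pos by auto
        from lt obtain c :: real where c: "ereal u * f x + ereal v * f y < ereal c"
          "ereal c < f (u *\<^sub>R x + v *\<^sub>R y)"
          using ereal_dense2 by blast
        have "\<exists>r s. f x \<le> ereal r \<and> f y \<le> ereal s \<and> u * r + v * s \<le> c"
        proof (cases "f x"; cases "f y")
          fix r s assume "f x = ereal r" "f y = ereal s"
          then show ?thesis using c by (intro exI[of _ r] exI[of _ s]) auto
        next
          fix r assume "f x = ereal r" "f y = -\<infinity>"
          then show ?thesis using pos
            by (intro exI[of _ r] exI[of _ "(c - u * r) / v"]) auto
        next
          fix s assume "f x = -\<infinity>" "f y = ereal s"
          then show ?thesis using pos
            by (intro exI[of _ "(c - v * s) / u"] exI[of _ s]) auto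
        next
          assume "f x = -\<infinity>" "f y = -\<infinity>"
          then show ?thesis using pos
            by (intro exI[of _ "c / u"] exI[of _ 0]) auto
        qed (use fin in auto)
        then obtain r s where "f x \<le> ereal r" "f y \<le> ereal s" "u * r + v * s \<le> c"
          by blast
        then have "f (u *\<^sub>R x + v *\<^sub>R y) \<le> ereal c"
          using E'[of x r y s u v] uv by (meson ereal_less_eq(3) order_trans)
        with c show False by simp
      qed
    qed
  qed
qed

definition lsc_ereal :: "('b::topological_space \<Rightarrow> ereal) \<Rightarrow> bool"
  where "lsc_ereal f \<longleftrightarrow> (\<forall>x. f x \<le> Liminf (at x) f)"

definition convex_representations ::
    "('a::real_normed_vector \<times> ('a \<Rightarrow>\<^sub>L real)) set \<Rightarrow> ('a \<times> ('a \<Rightarrow>\<^sub>L real) \<Rightarrow> ereal) set"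
  where "convex_representations T =
    {h. convex_ereal h \<and> lsc_ereal h \<and>
        (\<forall>x xs. ereal (duality x xs) \<le> h (x, xs)) \<and>
        (\<forall>(x, xs)\<in>T. h (x, xs) = ereal (duality x xs))}"

definition J_conj ::
    "('a::real_normed_vector \<times> ('a \<Rightarrow>\<^sub>L real) \<Rightarrow> ereal) \<Rightarrow> 'a \<times> ('a \<Rightarrow>\<^sub>L real) \<Rightarrow> ereal"
  where "J_conj h = (\<lambda>(x, xs).
    SUP (y, ys)\<in>UNIV. ereal (duality x ys + duality y xs) - h (y, ys))"

end

theory Submission
  imports Defs
begin

text \<open>Write \<open>B z w = \<langle>x, y\<^sup>*\<rangle> + \<langle>y, x\<^sup>*\<rangle>\<close> for \<open>z = (x, x\<^sup>*)\<close> and \<open>w = (y, y\<^sup>*)\<close>, so that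
  \<open>\<J>h z = sup\<^sub>w B z w - h w\<close> and \<open>B z z = 2\<langle>x, x\<^sup>*\<rangle>\<close>. The condition \<open>\<J>h \<le> h\<close> says
  \<open>B z w \<le> h z + h w\<close> for all \<open>z\<close> and \<open>w\<close>; by monotonicity of \<open>T\<close> it holds for the function
  \<open>h\<^sub>0\<close> that is the duality product on \<open>T\<close> and \<open>\<infinity>\<close> elsewhere. Zorn's lemma gives a minimal
  such \<open>h \<le> h\<^sub>0\<close>. If \<open>\<J>h z < h z\<close>, then lowering the value at the single point \<open>z\<close> to
  \<open>max (\<J>h z) (B z z / 2)\<close> preserves the condition, which contradicts minimality; so \<open>\<J>h = h\<close>.
  Being a conjugate, \<open>h\<close> is convex and lower semicontinuous, the condition at \<open>z = w\<close> gives
  \<open>h \<ge> \<langle>\<cdot>, \<cdot>\<rangle>\<close>, and \<open>h \<le> h\<^sub>0\<close> gives equality on \<open>T\<close>.\<close>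

definition self_dominating :: "('b \<Rightarrow> 'b \<Rightarrow> real) \<Rightarrow> ('b \<Rightarrow> ereal) \<Rightarrow> bool"
  where "self_dominating B h \<longleftrightarrow> (\<forall>z w. ereal (B z w) \<le> h z + h w)"

text \<open>In \<open>ereal\<close>, \<infinity> + (-\<infinity>) = \<infinity>, so a partner value
  \<infinity> would let -\<infinity> pass; the diagonal pair forbids it.\<close>

lemma self_dominating_not_MInf:
  assumes "self_dominating B h"
  shows "h z \<noteq> -\<infinity>"
proof
  assume "h z = -\<infinity>"
  with assms have "ereal (B z z) \<le> -\<infinity> + -\<infinity>"
    unfolding self_dominating_def by metis
  then show False by simp
qed

lemma self_dominating_diagonal:
  assumes "self_dominating B h"
  shows "ereal (B z z / 2) \<le> h z"
proof -
  have "ereal (B z z) \<le> h z + h z"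
    using assms unfolding self_dominating_def by blast
  then show ?thesis by (cases "h z") auto
qed

text \<open>The smaller of two chain members bounds the sum of values taken from both, one at each
  point; the infima at \<open>z\<close> and at \<open>w\<close> can then be taken
  independently.\<close>

lemma self_dominating_Inf_chain:
  assumes dom: "\<And>g. g \<in> C \<Longrightarrow> self_dominating B g"
    and chain: "\<And>f g. f \<in> C \<Longrightarrow> g \<in> C \<Longrightarrow> f \<le> g \<or> g \<le> f"
  shows "self_dominating B (Inf C)"
  unfolding self_dominating_def
proof (intro allI)
  fix z w
  have pair: "ereal (B z w) \<le> f z + g w" if "f \<in> C" "g \<in> C" for f g
    using chain[OF that]
  proof
    assume "f \<le> g"
    then have "f z + f w \<le> f z + g w" by (simp add: add_left_mono le_funD)
    then show ?thesis
      using dom[OF that(1)] unfolding self_dominating_def by (meson order_trans)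
  next
    assume "g \<le> f"
    then have "g z + g w \<le> f z + g w" by (simp add: add_right_mono le_funD)
    then show ?thesis
      using dom[OF that(2)] unfolding self_dominating_def by (meson order_trans)
  qed
  \<comment> \<open>The diagonal bound is uniform over the chain, so the infimum stays above
    -\<infinity> and terms can be moved across the inequality.\<close>
  have lower: "ereal (B v v / 2) \<le> Inf C v" for v
    unfolding Inf_fun_def by (intro INF_greatest self_dominating_diagonal dom)
  have fin: "Inf C v \<noteq> -\<infinity>" for v
    using lower[of v] by (cases "Inf C v") auto
  have "ereal (B z w) - Inf C w \<le> f z" if f: "f \<in> C" for f
  proof -
    have "ereal (B z w) - f z \<le> Inf C w"
      unfolding Inf_fun_def
    proof (rule INF_greatest)
      fix g assume "g \<in> C"
      with pair[OF f this] self_dominating_not_MInf[OF dom[OF f], of z]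
      show "ereal (B z w) - f z \<le> g w"
        by (cases "f z"; cases "g w") auto
    qed
    then show ?thesis
      using self_dominating_not_MInf[OF dom[OF f], of z] fin[of w]
      by (cases "f z"; cases "Inf C w") auto
  qed
  then have "ereal (B z w) - Inf C w \<le> Inf C z"
    unfolding Inf_fun_def[of C] by (intro INF_greatest)
  then show "ereal (B z w) \<le> Inf C z + Inf C w"
    using fin[of z] fin[of w] by (cases "Inf C z"; cases "Inf C w") auto
qed

lemma exists_minimal_self_dominating:
  assumes "self_dominating B h0"
  obtains h where "self_dominating B h" "h \<le> h0"
    "\<And>g. self_dominating B g \<Longrightarrow> g \<le> h \<Longrightarrow> g = h"
proof -
  let ?A = "{h. self_dominating B h \<and> h \<le> h0}"
  \<comment> \<open>Zorn's lemma yields a maximal element, so the order is reversed.\<close>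
  have po: "partial_order_on ?A (relation_of (\<lambda>f g. g \<le> f) ?A)"
    by (rule partial_order_on_relation_ofI) auto
  have "\<exists>u\<in>?A. \<forall>g\<in>C. u \<le> g" if C: "C \<in> Chains (relation_of (\<lambda>f g. g \<le> f) ?A)" for C
  proof -
    have sub: "C \<subseteq> ?A"
      by (rule Chains_relation_of[OF C])
    have chain: "f \<le> g \<or> g \<le> f" if "f \<in> C" "g \<in> C" for f g
      using C that unfolding Chains_def relation_of_def by blast
    \<comment> \<open>Inserting \<open>h0\<close> keeps the infimum below \<open>h0\<close> even for
      the empty chain, whose own infimum is constantly \<infinity>.\<close>
    have "self_dominating B (Inf (insert h0 C))"
      using assms sub chain by (intro self_dominating_Inf_chain) blast+
    then show ?thesis
      by (intro bexI[of _ "Inf (insert h0 C)"]) (auto intro: le_infI2 Inf_lower)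
  qed
  from predicate_Zorn[OF po this] obtain h where "h \<in> ?A" "\<And>g. g \<in> ?A \<Longrightarrow> g \<le> h \<Longrightarrow> g = h"
    by blast
  then show thesis
    by (intro that[of h]) (auto intro: order_trans)
qed

lemma self_dominating_fixed_point:
  assumes sym: "\<And>z w. B z w = B w z" and "self_dominating B h0"
  obtains h where "self_dominating B h" "h \<le> h0"
    "\<And>z. (SUP w. ereal (B z w) - h w) = h z"
proof -
  obtain h where dom: "self_dominating B h" and le: "h \<le> h0"
    and min: "\<And>g. self_dominating B g \<Longrightarrow> g \<le> h \<Longrightarrow> g = h"
    using exists_minimal_self_dominating[OF assms(2)] by blast
  have fin: "h w \<noteq> -\<infinity>" for w
    by (rule self_dominating_not_MInf[OF dom])
  have domD: "ereal (B z w) \<le> h z + h w" for z w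
    using dom unfolding self_dominating_def by blast
  have "(SUP w. ereal (B z w) - h w) = h z" for z
  proof -
    let ?J = "SUP w. ereal (B z w) - h w"
    \<comment> \<open>The first entry secures the pairs of \<open>z\<close> with other points, the
      second the pair of \<open>z\<close> with itself, where the lowered value counts twice.\<close>
    define c where "c = max ?J (ereal (B z z / 2))"
    have "?J \<le> h z"
    proof (rule SUP_least)
      fix w
      show "ereal (B z w) - h w \<le> h z"
        using domD[of z w] fin[of w] fin[of z] by (cases "h z"; cases "h w") auto
    qed
    then have "c \<le> h z"
      unfolding c_def using self_dominating_diagonal[OF dom] by simp
    have zw: "ereal (B z w) \<le> c + h w" for w
    proof -
      have "ereal (B z w) - h w \<le> c"
        unfolding c_def by (intro max.coboundedI1 SUP_upper) simp
      then show ?thesis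
        using fin[of w] by (cases c; cases "h w") auto
    qed
    have zz: "ereal (B z z) \<le> c + c"
    proof -
      have "ereal (B z z / 2) \<le> c" unfolding c_def by simp
      then show ?thesis by (cases c) auto
    qed
    have "self_dominating B (h(z := c))"
      unfolding self_dominating_def
    proof (intro allI)
      fix v w
      have "ereal (B v z) \<le> h v + c"
        using zw[of v] by (simp add: sym[of v z] add.commute)
      then show "ereal (B v w) \<le> (h(z := c)) v + (h(z := c)) w"
        using zw[of w] zz domD[of v w] by simp
    qed
    moreover have "h(z := c) \<le> h"
      using \<open>c \<le> h z\<close> by (simp add: le_fun_def)
    ultimately have "h z = c"
      using fun_cong[OF min, of "h(z := c)" z] by simp
    \<comment> \<open>If the maximum is the diagonal value, the term \<open>w = z\<close> of the
      supremum is \<open>B z z - B z z / 2\<close>, so \<open>?J\<close> reaches it too.\<close>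
    moreover have "ereal (B z z / 2) \<le> ?J" if "h z = ereal (B z z / 2)"
    proof -
      have "ereal (B z z / 2) = ereal (B z z) - h z" using that by simp
      also have "\<dots> \<le> ?J" by (rule SUP_upper) simp
      finally show ?thesis .
    qed
    ultimately show ?thesis
      unfolding c_def by (simp add: max_def split: if_splits)
  qed
  with dom le show thesis by (rule that)
qed

lemma convex_ereal_SUP:
  assumes "\<And>i. i \<in> I \<Longrightarrow> convex_ereal (f i)"
  shows "convex_ereal (\<lambda>x. SUP i\<in>I. f i x)"
  unfolding convex_ereal_def
proof (intro allI impI SUP_least)
  fix x y and u v :: real and i
  assume uv: "0 \<le> u" "0 \<le> v" "u + v = 1" and i: "i \<in> I"
  have "f i (u *\<^sub>R x + v *\<^sub>R y) \<le> ereal u * f i x + ereal v * f i y"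
    using assms[OF i] uv unfolding convex_ereal_def by blast
  also have "\<dots> \<le> ereal u * (SUP i\<in>I. f i x) + ereal v * (SUP i\<in>I. f i y)"
    using uv i by (intro add_mono ereal_mult_left_mono SUP_upper) auto
  finally show "f i (u *\<^sub>R x + v *\<^sub>R y)
      \<le> ereal u * (SUP i\<in>I. f i x) + ereal v * (SUP i\<in>I. f i y)" .
qed

lemma convex_ereal_linear_minus_const:
  assumes "linear l"
  shows "convex_ereal (\<lambda>x. ereal (l x) - a)"
  unfolding convex_ereal_iff_convex_epigraph
proof (cases a)
  case (real r)
  show "convex {(x, s). ereal (l x) - a \<le> ereal s}"
  proof (rule convexI, clarsimp simp: real)
    fix x y s t and u v :: real
    assume "l x - r \<le> s" "l y - r \<le> t" and uv: "0 \<le> u" "0 \<le> v" "u + v = 1"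
    then have "u * (l x - r) + v * (l y - r) \<le> u * s + v * t"
      by (intro add_mono mult_left_mono)
    moreover have "u * r + v * r = r"
      using uv by (simp flip: distrib_right)
    ultimately show "l (u *\<^sub>R x + v *\<^sub>R y) - r \<le> u * s + v * t"
      using assms by (simp add: linear_add linear_scale right_diff_distrib)
  qed
\<comment> \<open>An infinite \<open>a\<close> makes the function constant, with epigraph empty or
  everything.\<close>
qed (auto simp: convex_def)

lemma lsc_ereal_SUP:
  assumes "\<And>i. i \<in> I \<Longrightarrow> lsc_ereal (f i)"
  shows "lsc_ereal (\<lambda>x. SUP i\<in>I. f i x)"
  unfolding lsc_ereal_def
proof (intro allI SUP_least)
  fix x i assume i: "i \<in> I"
  have "f i x \<le> Liminf (at x) (f i)"
    using assms[OF i] unfolding lsc_ereal_def by blast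
  also have "\<dots> \<le> Liminf (at x) (\<lambda>x. SUP i\<in>I. f i x)"
    using i by (intro Liminf_mono always_eventually) (auto intro: SUP_upper)
  finally show "f i x \<le> Liminf (at x) (\<lambda>x. SUP i\<in>I. f i x)" .
qed

lemma lsc_ereal_continuous_minus_const:
  fixes l :: "'b::topological_space \<Rightarrow> real"
  assumes "continuous_on UNIV l"
  shows "lsc_ereal (\<lambda>x. ereal (l x) - a)"
  unfolding lsc_ereal_def
proof
  fix x
  have "((\<lambda>x. ereal (l x) - a) \<longlongrightarrow> ereal (l x) - a) (at x)"
  proof (cases a)
    case (real r)
    then show ?thesis
      using assms by (auto simp: continuous_on_def intro: tendsto_diff)
  qed auto
  then show "ereal (l x) - a \<le> Liminf (at x) (\<lambda>x. ereal (l x) - a)"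
    \<comment> \<open>Eventual strict lower bounds also cover an isolated \<open>x\<close>, where
      \<open>at x\<close> is trivial.\<close>
    unfolding le_Liminf_iff by (auto dest: order_tendstoD(1))
qed

definition dual_pairing ::
    "'a::real_normed_vector \<times> ('a \<Rightarrow>\<^sub>L real) \<Rightarrow> 'a \<times> ('a \<Rightarrow>\<^sub>L real) \<Rightarrow> real"
  where "dual_pairing z w = duality (fst z) (snd w) + duality (fst w) (snd z)"

lemma J_conj_eq_SUP_dual_pairing:
  "J_conj h = (\<lambda>z. SUP w. ereal (dual_pairing z w) - h w)"
  by (auto simp: J_conj_def dual_pairing_def fun_eq_iff intro!: SUP_cong)

text \<open>Each term of the supremum defining \<open>J_conj h\<close> is thus continuous affine in
  \<open>z\<close>, or constant where \<open>h w\<close> is infinite, which makes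
  \<open>J_conj h\<close> convex and lower semicontinuous for every \<open>h\<close>.\<close>

lemma bounded_linear_dual_pairing: "bounded_linear (\<lambda>z. dual_pairing z w)"
  unfolding dual_pairing_def duality_def
  by (intro bounded_linear_add
      bounded_linear_compose[OF blinfun.bounded_linear_right bounded_linear_fst]
      bounded_linear_compose[OF blinfun.bounded_linear_left bounded_linear_snd])

lemma convex_J_conj: "convex_ereal (J_conj h)"
  unfolding J_conj_eq_SUP_dual_pairing
  by (intro convex_ereal_SUP convex_ereal_linear_minus_const bounded_linear.linear
      bounded_linear_dual_pairing)

lemma lsc_J_conj: "lsc_ereal (J_conj h)"
  unfolding J_conj_eq_SUP_dual_pairing
  by (intro lsc_ereal_SUP lsc_ereal_continuous_minus_const linear_continuous_on
      bounded_linear_dual_pairing)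

text \<open>Expanding the monotonicity inequality, the two cross terms form
  \<open>dual_pairing\<close>; if a point lies outside \<open>T\<close>, the right-hand side is
  \<infinity>.\<close>

lemma self_dominating_monotone_op:
  assumes "monotone_op T"
  shows "self_dominating dual_pairing
    (\<lambda>z. if z \<in> T then ereal (duality (fst z) (snd z)) else \<infinity>)"
proof -
  have "dual_pairing z w \<le> duality (fst z) (snd z) + duality (fst w) (snd w)"
    if "z \<in> T" "w \<in> T" for z w
  proof -
    have "0 \<le> duality (fst z - fst w) (snd z - snd w)"
      using assms that unfolding monotone_op_def by fastforce
    then show ?thesis
      unfolding dual_pairing_def duality_def
      by (simp add: blinfun.diff_left blinfun.diff_right)
  qed
  then show ?thesis
    unfolding self_dominating_def by auto
qed

theorem mainTheorem1:
  fixes T :: "('a::banach \<times> ('a \<Rightarrow>\<^sub>L real)) set"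
  assumes "maximal_monotone_op T"
  shows "\<exists>h \<in> convex_representations T. J_conj h = h"
proof -
  have "monotone_op T"
    using assms unfolding maximal_monotone_op_def by blast
  note dom0 = self_dominating_monotone_op[OF this]
  have sym: "dual_pairing z w = dual_pairing w z" for z w :: "'a \<times> ('a \<Rightarrow>\<^sub>L real)"
    by (simp add: dual_pairing_def)
  obtain h where dom: "self_dominating dual_pairing h"
    and le: "h \<le> (\<lambda>z. if z \<in> T then ereal (duality (fst z) (snd z)) else \<infinity>)"
    and fixed: "\<And>z. (SUP w. ereal (dual_pairing z w) - h w) = h z"
    by (rule self_dominating_fixed_point[OF sym dom0]) blast
  have J: "J_conj h = h"
    unfolding J_conj_eq_SUP_dual_pairing using fixed by blast
  have lower: "ereal (duality x xs) \<le> h (x, xs)" for x xs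
    using self_dominating_diagonal[OF dom, of "(x, xs)"] by (simp add: dual_pairing_def)
  have "h (x, xs) = ereal (duality x xs)" if "(x, xs) \<in> T" for x xs
    using le_funD[OF le, of "(x, xs)"] that lower[of x xs] by (simp add: antisym)
  then have "h \<in> convex_representations T"
    using convex_J_conj[of h] lsc_J_conj[of h] lower
    unfolding convex_representations_def J by blast
  with J show ?thesis by blast
qed

end
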